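(* Let $G$ be a special linear or symplectic algebraic group over an algebraically closed field, with natural module $V$ of dimension $n$. Let $C_1,\dots,C_e$ be conjugacy classes of $G$, $\Omega=C_1\times\dots\times C_e$, and let $\gamma_j$ be the dimension of the largest eigenspace on $V$ of an element of $C_j$. Then $\sum_{j=1}^e\gamma_j\leq n(e-1)$ if and only if there is a tuple $(x_1,\dots,x_e)\in\Omega$ such that no $1$-dimensional subspace of $V$ is fixed by all of $x_1,\dots,x_e$. *)

theory Defs
  imports "HOL-Analysis.Analysis" "HOL-Computational_Algebra.Polynomial"
begin

text \<open>Matrices over a field act on the natural module 'a^'n by (*v).
  The dimension n of the natural module is CARD('n).\<close>

definition SL_group :: "('a::field ^'n ^'n) set" where
  "SL_group = {A. det A = 1}"

text \<open>Nondegenerate alternating bilinear form, given by its Gram matrix J.\<close>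
definition alternating_nondeg :: "('a::field ^'n ^'n) \<Rightarrow> bool" where
  "alternating_nondeg J \<longleftrightarrow> transpose J = - J \<and> (\<forall>i. J $ i $ i = 0) \<and> det J \<noteq> 0"

text \<open>Symplectic group of the form with Gram matrix J.\<close>
definition Sp_group :: "('a::field ^'n ^'n) \<Rightarrow> ('a ^'n ^'n) set" where
  "Sp_group J = {A. transpose A ** J ** A = J}"

definition conj_class :: "('a::field ^'n ^'n) set \<Rightarrow> ('a ^'n ^'n) \<Rightarrow> ('a ^'n ^'n) set" where
  "conj_class G x = {g ** x ** matrix_inv g | g. g \<in> G}"

definition eigenspace :: "('a::field ^'n ^'n) \<Rightarrow> 'a \<Rightarrow> ('a ^'n) set" where
  "eigenspace A c = {v. A *v v = c *s v}"

text \<open>Dimension of the largest eigenspace of A on the natural module.\<close>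
definition max_eigenspace_dim :: "('a::field ^'n ^'n) \<Rightarrow> nat" where
  "max_eigenspace_dim A = Max {vec.dim (eigenspace A c) | c. True}"

text \<open>The 1-dimensional subspace L is fixed by A.\<close>
definition fixes_subspace :: "('a::field ^'n ^'n) \<Rightarrow> ('a ^'n) set \<Rightarrow> bool" where
  "fixes_subspace A L \<longleftrightarrow> (\<lambda>v. A *v v) ` L = L"

end

theory Submission
  imports Defs
begin

text \<open>
  If \<open>\<Sum>j \<gamma>j > n (e - 1)\<close>, then for any conjugates \<open>x\<^sub>j\<close> of the \<open>c\<^sub>j\<close> the eigenspaces
  of dimension \<open>\<gamma>\<^sub>j\<close> of the \<open>x\<^sub>j\<close> meet nontrivially by dimension counting, and a common
  eigenvector spans a line fixed by all \<open>x\<^sub>j\<close>.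

  Conversely, conjugating \<open>c\<^sub>j\<close> by \<open>g\<^sub>j\<close> moves its finitely many eigenspaces by \<open>g\<^sub>j\<close>.
  Choosing \<open>g\<^sub>1, g\<^sub>2, \<dots>\<close> one at a time so that the moved eigenspaces are in general
  position with respect to all intersections formed so far, every intersection
  \<open>\<Inter>j g\<^sub>j E\<^sub>j\<close> of eigenspaces has dimension \<open>max 0 (\<Sum>j dim E\<^sub>j - n (e - 1)) = 0\<close>, so
  there is no common eigenvector. General position is reached by minimising
  \<open>\<Sum> dim (W \<inter> g U)\<close> over \<open>g \<in> G\<close>: if some pair is not in general position, a suitable
  transvection in \<open>G\<close> decreases the sum. Over an infinite field, \<open>GL\<^sub>n\<close> and \<open>Sp\<^sub>n\<close> contain
  enough transvections; for \<open>SL\<^sub>n\<close> we work in \<open>GL\<^sub>n\<close> and rescale by scalars, which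
  does not move subspaces.
\<close>

section \<open>Bilinear pairing and transvections\<close>

definition dot :: "'a::comm_ring_1 ^'n \<Rightarrow> 'a ^'n \<Rightarrow> 'a" where
  "dot x y = (\<Sum>i\<in>UNIV. x $ i * y $ i)"

lemma dot_commute: "dot x y = dot y x"
  by (simp add: dot_def mult.commute)

lemma dot_add_right: "dot z (x + y) = dot z x + dot z y"
  by (simp add: dot_def distrib_left sum.distrib)

lemma dot_scale_left: "dot (c *s x) y = c * dot x y"
  by (simp add: dot_def sum_distrib_left mult.assoc)

lemma dot_scale_right: "dot x (c *s y) = c * dot x y"
  by (simp add: dot_def sum_distrib_left mult.left_commute)

lemma dot_diff_right: "dot z (x - y) = dot z x - dot z y"
  by (simp add: dot_def right_diff_distrib sum_subtractf)

lemma dot_diff_left: "dot (x - y) z = dot x z - dot y z"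
  by (simp add: dot_def left_diff_distrib sum_subtractf)

lemma dot_neg_left: "dot (- x) y = - dot x y"
  by (simp add: dot_def sum_negf)

lemma dot_zero_right [simp]: "dot x 0 = 0"
  by (simp add: dot_def)

lemma dot_axis_left [simp]: "dot (axis i c) y = c * y $ i"
  by (simp add: dot_def axis_def mult_delta_left)

lemma dot_transpose: "dot x (transpose A *v y) = dot (A *v x) y"
  unfolding dot_def matrix_vector_mult_def transpose_def
  by (simp add: sum_distrib_left sum_distrib_right mult_ac) (rule sum.swap)

definition transvection :: "'a::comm_ring_1 \<Rightarrow> 'a ^'n \<Rightarrow> 'a ^'n \<Rightarrow> 'a ^'n ^'n" where
  "transvection t v f = mat 1 + (\<chi> i j. t * v $ i * f $ j)"

lemma transvection_apply: "transvection t v f *v y = y + (t * dot f y) *s v"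
proof -
  have "(\<chi> i j. t * v $ i * f $ j) *v y = (t * dot f y) *s v"
    by (simp add: vec_eq_iff matrix_vector_mult_def dot_def sum_distrib_left mult_ac)
  then show ?thesis
    by (simp add: transvection_def matrix_vector_mult_add_rdistrib)
qed

lemma transpose_transvection: "transpose (transvection t v f) = transvection t f v"
  by (simp add: transvection_def transpose_def vec_eq_iff mat_def mult_ac)

lemma transvection_inverse:
  assumes "dot f v = 0"
  shows "transvection (- t) v f ** transvection t v f = mat 1"
proof (rule matrix_eq[THEN iffD2], rule allI)
  fix y
  have "dot f (transvection t v f *v y) = dot f y"
    by (simp add: transvection_apply dot_add_right dot_scale_right assms)
  then have "transvection (- t) v f *v (transvection t v f *v y)
      = transvection t v f *v y + (- t * dot f y) *s v"
    by (simp only: transvection_apply[of "- t" v f])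
  also have "\<dots> = y"
    by (simp add: transvection_apply vec_eq_iff algebra_simps)
  finally
  show "(transvection (- t) v f ** transvection t v f) *v y = mat 1 *v y"
    by (simp add: matrix_vector_mul_assoc)
qed

lemma invertible_transvection:
  fixes v f :: "'a::field ^'n"
  shows "dot f v = 0 \<Longrightarrow> invertible (transvection t v f)"
  unfolding invertible_left_inverse using transvection_inverse by blast

section \<open>Subspaces\<close>

definition subspace_sum :: "('a::field ^'n) set \<Rightarrow> ('a ^'n) set \<Rightarrow> ('a ^'n) set" where
  "subspace_sum W U = {w + u | w u. w \<in> W \<and> u \<in> U}"

lemma subspace_subspace_sum:
  "vec.subspace W \<Longrightarrow> vec.subspace U \<Longrightarrow> vec.subspace (subspace_sum W U)"
  unfolding subspace_sum_def by (rule vec.subspace_sums)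

lemma subspace_sum_upper_left: "vec.subspace U \<Longrightarrow> W \<subseteq> subspace_sum W U"
  unfolding subspace_sum_def by (force dest: vec.subspace_0)

lemma subspace_sum_upper_right: "vec.subspace W \<Longrightarrow> U \<subseteq> subspace_sum W U"
  unfolding subspace_sum_def by (force dest: vec.subspace_0)

lemma dim_subspace_sum_Int:
  "vec.subspace W \<Longrightarrow> vec.subspace U \<Longrightarrow>
    vec.dim (subspace_sum W U) + vec.dim (W \<inter> U) = vec.dim W + vec.dim U"
  unfolding subspace_sum_def by (rule vec.dim_sums_Int)

lemma dim_le_CARD: "vec.dim (S :: ('a::field ^'n) set) \<le> CARD('n)"
  using vec.dim_subset_UNIV[of S] by (simp add: vec.dimension_def card_cart_basis)

lemma dim_image_invertible:
  fixes g :: "'a::field ^'n ^'n"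
  assumes "invertible g"
  shows "vec.dim ((*v) g ` U) = vec.dim U"
  by (rule vec.dim_image_eq) (use inj_matrix_vector_mult[OF assms] in \<open>auto intro: inj_on_subset\<close>)

lemma subspace_matrix_image: "vec.subspace U \<Longrightarrow> vec.subspace ((*v) A ` U)"
  by (rule vec.subspace_image)

lemma subspace_INT_lessThan:
  "(\<And>j. j < e \<Longrightarrow> vec.subspace (A j)) \<Longrightarrow> vec.subspace (\<Inter>j<e. A j)"
  by (rule vec.subspace_Inter) auto

lemma subspace_kernel_dot: "vec.subspace V \<Longrightarrow> vec.subspace {y \<in> V. dot f y = 0}"
  unfolding vec.subspace_def by (auto simp: dot_add_right dot_scale_right)

lemma dim_kernel_dot_less:
  assumes V: "vec.subspace V" and x: "x \<in> V" "dot f x \<noteq> 0"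
  shows "vec.dim {y \<in> V. dot f y = 0} < vec.dim V"
proof (rule vec.dim_psubset)
  show "vec.span {y \<in> V. dot f y = 0} \<subset> vec.span V"
    using x by (auto simp: vec.span_eq_iff[THEN iffD2, OF subspace_kernel_dot[OF V]]
        vec.span_eq_iff[THEN iffD2, OF V])
qed

lemma line_in_subspace_if_two_points:
  assumes S: "vec.subspace S" and a: "u + a *s w \<in> S" and b: "u + b *s w \<in> S" and "a \<noteq> b"
  shows "u \<in> S \<and> w \<in> S"
proof -
  have "(u + a *s w) - (u + b *s w) = (a - b) *s w"
    by (simp add: vec.scale_left_diff_distrib)
  then have "(a - b) *s w \<in> S"
    using vec.subspace_diff[OF S a b] by simp
  then have "(1 / (a - b)) *s ((a - b) *s w) \<in> S"
    using S vec.subspace_scale by blast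
  then have w: "w \<in> S"
    using \<open>a \<noteq> b\<close> by (simp only: vector_smult_assoc) simp
  have "u = (u + a *s w) - a *s w" by simp
  then have "u \<in> S"
    using vec.subspace_diff[OF S a vec.subspace_scale[OF S w, of a]] by simp
  with w show ?thesis by blast
qed

lemma finite_line_params_in_subspace:
  assumes "vec.subspace S" "u \<notin> S"
  shows "finite {c. u + c *s w \<in> S}"
proof (cases "\<exists>a. u + a *s w \<in> S")
  case True
  then obtain a where "u + a *s w \<in> S" by blast
  then have "{c. u + c *s w \<in> S} \<subseteq> {a}"
    using line_in_subspace_if_two_points assms by blast
  then show ?thesis by (rule finite_subset) simp
qed simp

lemma ex_not_in_finite_Union_proper_subspaces:
  fixes S :: "('a::field ^'n) set set"
  assumes "infinite (UNIV :: 'a set)" and "finite S" and "\<forall>s\<in>S. vec.subspace s \<and> s \<noteq> UNIV"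
  shows "\<exists>v. \<forall>s\<in>S. v \<notin> s"
  using assms(2,3)
proof (induction S rule: finite_induct)
  case (insert s S)
  then obtain v where v: "\<forall>s'\<in>S. v \<notin> s'" by auto
  have s: "vec.subspace s" "s \<noteq> UNIV" using insert.prems by auto
  show ?case
  proof (cases "v \<in> s")
    case True
    obtain w where w: "w \<notin> s" using s by auto
    have "finite {c. v + c *s w \<in> s'}" if "s' \<in> S" for s'
      using finite_line_params_in_subspace that insert.prems v by blast
    then have fin: "finite (insert 0 (\<Union>s'\<in>S. {c. v + c *s w \<in> s'}))"
      using insert.hyps(1) by blast
    obtain c where c: "c \<notin> insert 0 (\<Union>s'\<in>S. {c. v + c *s w \<in> s'})"
      using ex_new_if_finite[OF assms(1) fin] by blast
    have "v + c *s w \<notin> s"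
      using line_in_subspace_if_two_points[OF s(1), of v 0 w c] True w c by auto
    with c show ?thesis by auto
  qed (use v in auto)
qed simp

lemma dim_INT_ge:
  fixes E :: "nat \<Rightarrow> ('a::field ^'n) set"
  assumes "\<And>j. j < e \<Longrightarrow> vec.subspace (E j)"
  shows "(\<Sum>j<e. int (vec.dim (E j))) - int CARD('n) * (int e - 1) \<le> int (vec.dim (\<Inter>j<e. E j))"
  using assms
proof (induction e)
  case 0
  show ?case by (simp add: card_cart_basis)
next
  case (Suc e)
  let ?I = "\<Inter>j<e. E j"
  have "vec.subspace ?I" "vec.subspace (E e)"
    using Suc.prems by (auto intro: subspace_INT_lessThan)
  then have "vec.dim (subspace_sum ?I (E e)) + vec.dim (?I \<inter> E e) = vec.dim ?I + vec.dim (E e)"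
    by (rule dim_subspace_sum_Int)
  moreover have "vec.dim (subspace_sum ?I (E e)) \<le> CARD('n)"
    by (rule dim_le_CARD)
  moreover have "(\<Inter>j<Suc e. E j) = ?I \<inter> E e"
    by (auto simp: lessThan_Suc)
  ultimately show ?case
    using Suc by (simp add: algebra_simps)
qed

section \<open>General position\<close>

definition general_position :: "('a::field ^'n) set \<Rightarrow> ('a ^'n) set \<Rightarrow> bool" where
  "general_position W U \<longleftrightarrow> W \<inter> U = {0} \<or> subspace_sum W U = UNIV"

lemma dim_Int_general_position:
  fixes W U :: "('a::field ^'n) set"
  assumes "vec.subspace W" "vec.subspace U" "general_position W U"
  shows "int (vec.dim (W \<inter> U)) \<le> max 0 (int (vec.dim W) + int (vec.dim U) - int CARD('n))"
proof (cases "W \<inter> U = {0}")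
  case False
  with assms(3) have "subspace_sum W U = UNIV"
    unfolding general_position_def by blast
  with dim_subspace_sum_Int[OF assms(1,2)]
  have "CARD('n) + vec.dim (W \<inter> U) = vec.dim W + vec.dim U"
    by (simp add: card_cart_basis)
  then show ?thesis by linarith
qed simp

lemma Int_transvection_image_subset:
  assumes W: "vec.subspace W" and U: "vec.subspace U"
    and v: "v \<notin> subspace_sum W U" and t: "t \<noteq> 0"
  shows "W \<inter> (*v) (transvection t v f) ` U \<subseteq> {y \<in> W \<inter> U. dot f y = 0}"
proof
  fix z assume "z \<in> W \<inter> (*v) (transvection t v f) ` U"
  then obtain y where z: "z \<in> W" and y: "y \<in> U" "z = y + (t * dot f y) *s v"
    by (auto simp: transvection_apply)
  have "dot f y = 0"
  proof (rule ccontr)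
    assume "dot f y \<noteq> 0"
    then have "v = (1 / (t * dot f y)) *s (z + (- 1) *s y)"
      using t y(2) by (simp add: vector_smult_assoc)
    moreover have "z + (- 1) *s y \<in> subspace_sum W U"
      using z vec.subspace_scale[OF U y(1)] unfolding subspace_sum_def by blast
    ultimately show False
      using v vec.subspace_scale[OF subspace_subspace_sum[OF W U]] by metis
  qed
  with y z show "z \<in> {y \<in> W \<inter> U. dot f y = 0}" by simp
qed

lemma dim_Int_transvection_image_le:
  assumes "vec.subspace W" "vec.subspace U" "v \<notin> subspace_sum W U" "t \<noteq> 0"
  shows "vec.dim (W \<inter> (*v) (transvection t v f) ` U) \<le> vec.dim (W \<inter> U)"
proof -
  have "W \<inter> (*v) (transvection t v f) ` U \<subseteq> W \<inter> U"
    using Int_transvection_image_subset[OF assms] by blast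
  then show ?thesis by (rule vec.dim_subset)
qed

lemma dim_Int_transvection_image_less:
  assumes W: "vec.subspace W" and U: "vec.subspace U"
    and "v \<notin> subspace_sum W U" "t \<noteq> 0" and x: "x \<in> W \<inter> U" "dot f x \<noteq> 0"
  shows "vec.dim (W \<inter> (*v) (transvection t v f) ` U) < vec.dim (W \<inter> U)"
  using vec.dim_subset[OF Int_transvection_image_subset[OF assms(1-4), of f]]
    dim_kernel_dot_less[OF vec.subspace_inter[OF W U] x] by linarith

lemma dim_Int_eq_if_subspace_sums_UNIV:
  assumes W: "vec.subspace W" and U: "vec.subspace U" and A: "invertible A"
    and "subspace_sum W U = UNIV" "subspace_sum W ((*v) A ` U) = UNIV"
  shows "vec.dim (W \<inter> (*v) A ` U) = vec.dim (W \<inter> U)"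
  using dim_subspace_sum_Int[OF W U] dim_subspace_sum_Int[OF W subspace_matrix_image[OF U, of A]]
    dim_image_invertible[OF A, of U] assms(4,5)
  by simp

lemma finite_transvection_params_not_spanning:
  assumes W: "vec.subspace W" and U: "vec.subspace U" and full: "subspace_sum W U = UNIV"
  shows "finite {t. subspace_sum W ((*v) (transvection t v f) ` U) \<noteq> UNIV}"
proof (cases "\<forall>u\<in>U. dot f u = 0")
  case True
  then have "(*v) (transvection t v f) ` U = U" for t
    by (simp add: transvection_apply cong: image_cong)
  with full show ?thesis by simp
next
  case False
  then obtain u1 where "u1 \<in> U" "dot f u1 \<noteq> 0" by blast
  define u0 where "u0 = (1 / dot f u1) *s u1"
  have u0: "u0 \<in> U" "dot f u0 = 1"
    using \<open>u1 \<in> U\<close> \<open>dot f u1 \<noteq> 0\<close> U by (simp_all add: u0_def dot_scale_right vec.subspace_scale)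
  define K where "K = {u \<in> U. dot f u = 0}"
  define Y where "Y = subspace_sum W K"
  have Y: "vec.subspace Y"
    unfolding Y_def K_def by (intro subspace_subspace_sum subspace_kernel_dot W U)
  have decomp: "\<exists>y\<in>Y. \<exists>s. z = y + s *s u0" for z
  proof -
    obtain w u where wu: "w \<in> W" "u \<in> U" "z = w + u"
      using full unfolding subspace_sum_def by blast
    have "u - dot f u *s u0 \<in> K"
      using wu(2) u0 U by (simp add: K_def dot_diff_right dot_scale_right vec.subspace_diff vec.subspace_scale)
    then have "w + (u - dot f u *s u0) \<in> Y"
      unfolding Y_def subspace_sum_def using wu(1) by blast
    moreover have "z = w + (u - dot f u *s u0) + dot f u *s u0"
      using wu(3) by simp
    ultimately show ?thesis by blast
  qed
  have UNIV_if_contains: "S = UNIV" if S: "vec.subspace S" "Y \<subseteq> S" "u0 \<in> S" for S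
  proof -
    have "z \<in> S" for z
    proof -
      obtain y s where "y \<in> Y" "z = y + s *s u0"
        using decomp by blast
      then show ?thesis
        using S by (blast intro: vec.subspace_add vec.subspace_scale)
    qed
    then show ?thesis by blast
  qed
  define S where "S t = subspace_sum W ((*v) (transvection t v f) ` U)" for t
  have S: "vec.subspace (S t)" for t
    unfolding S_def by (intro subspace_subspace_sum subspace_matrix_image W U)
  have Y_S: "Y \<subseteq> S t" for t
  proof
    fix z assume "z \<in> Y"
    then obtain w k where wk: "w \<in> W" "k \<in> U" "dot f k = 0" "z = w + k"
      unfolding Y_def K_def subspace_sum_def by blast
    then have "k = transvection t v f *v k"
      by (simp add: transvection_apply)
    with wk show "z \<in> S t"
      unfolding S_def subspace_sum_def by blast
  qed
  have line_S: "u0 + t *s v \<in> S t" for t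
  proof -
    have "u0 + t *s v = transvection t v f *v u0"
      by (simp add: transvection_apply u0)
    then show ?thesis
      using subspace_sum_upper_right[OF W] u0(1) unfolding S_def by blast
  qed
  show ?thesis
  proof (cases "u0 \<in> Y")
    case True
    then have "S t = UNIV" for t
      using UNIV_if_contains[OF Y] Y_S by blast
    then show ?thesis by (simp add: S_def)
  next
    case False
    have "S t = UNIV" if "u0 + t *s v \<notin> Y" for t
    proof -
      obtain y s where y: "y \<in> Y" "u0 + t *s v = y + s *s u0"
        using decomp by blast
      with that have "s \<noteq> 0" by auto
      have "u0 = (1 / s) *s ((u0 + t *s v) - y)"
        using y(2) \<open>s \<noteq> 0\<close> by (simp add: vector_smult_assoc)
      also have "\<dots> \<in> S t"
        using S line_S Y_S y(1) by (blast intro: vec.subspace_scale vec.subspace_diff)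
      finally show ?thesis
        using UNIV_if_contains S Y_S by blast
    qed
    then have "{t. S t \<noteq> UNIV} \<subseteq> {t. u0 + t *s v \<in> Y}" by blast
    moreover have "finite {t. u0 + t *s v \<in> Y}"
      by (rule finite_line_params_in_subspace[OF Y False])
    ultimately show ?thesis
      unfolding S_def by (rule finite_subset)
  qed
qed

locale transvection_rich_group =
  fixes H :: "('a::field ^'n ^'n) set"
  assumes infinite_field: "infinite (UNIV :: 'a set)"
    and one_mem: "mat 1 \<in> H"
    and mult_mem: "a \<in> H \<Longrightarrow> b \<in> H \<Longrightarrow> a ** b \<in> H"
    and invertible_mem: "a \<in> H \<Longrightarrow> invertible a"
    and transvections: "x \<noteq> 0 \<Longrightarrow> finite S \<Longrightarrow> \<forall>s\<in>S. vec.subspace s \<and> s \<noteq> UNIV \<Longrightarrow>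
      x \<in> \<Union>S \<Longrightarrow> \<exists>v f. v \<notin> \<Union>S \<and> dot f x \<noteq> 0 \<and> (\<forall>t. transvection t v f \<in> H)"
begin

lemma ex_transvection_avoiding_nonspanning_sums:
  assumes I: "finite I" and sub: "\<forall>i\<in>I. vec.subspace (W i) \<and> vec.subspace (U i)"
    and i0: "i0 \<in> I" "\<not> general_position (W i0) (U i0)"
  obtains x v f where "x \<in> W i0 \<inter> U i0" "dot f x \<noteq> 0" "\<forall>t. transvection t v f \<in> H"
    "\<forall>i\<in>I. subspace_sum (W i) (U i) \<noteq> UNIV \<longrightarrow> v \<notin> subspace_sum (W i) (U i)"
proof -
  obtain x where x: "x \<in> W i0 \<inter> U i0" "x \<noteq> 0"
    using i0 sub vec.subspace_0 unfolding general_position_def by blast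
  define S where "S = (\<lambda>i. subspace_sum (W i) (U i)) ` {i \<in> I. subspace_sum (W i) (U i) \<noteq> UNIV}"
  have "finite S"
    using I unfolding S_def by simp
  moreover have "\<forall>s\<in>S. vec.subspace s \<and> s \<noteq> UNIV"
    using sub unfolding S_def by (auto intro: subspace_subspace_sum)
  moreover have "x \<in> \<Union>S"
    using i0 x subspace_sum_upper_left[of "U i0" "W i0"] sub
    unfolding S_def general_position_def by blast
  ultimately have "\<exists>v f. v \<notin> \<Union>S \<and> dot f x \<noteq> 0 \<and> (\<forall>t. transvection t v f \<in> H)"
    by (rule transvections[OF x(2)])
  then obtain v f where v: "v \<notin> \<Union>S" and "dot f x \<noteq> 0" "\<forall>t. transvection t v f \<in> H"
    by blast
  moreover have "\<forall>i\<in>I. subspace_sum (W i) (U i) \<noteq> UNIV \<longrightarrow> v \<notin> subspace_sum (W i) (U i)"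
    using v unfolding S_def by blast
  ultimately show ?thesis
    using x(1) that by blast
qed

text \<open>
  Pairs with \<open>W + U = V\<close> keep this property for all but finitely many \<open>t\<close>; the other
  pairs can only lose dimension, and the pair \<open>i\<^sub>0\<close> loses the vector \<open>x\<close>.
\<close>

lemma ex_transvection_decreasing_overlap:
  assumes I: "finite I" and sub: "\<forall>i\<in>I. vec.subspace (W i) \<and> vec.subspace (U i)"
    and i0: "i0 \<in> I" "\<not> general_position (W i0) (U i0)"
  shows "\<exists>h\<in>H. (\<Sum>i\<in>I. vec.dim (W i \<inter> (*v) h ` U i)) < (\<Sum>i\<in>I. vec.dim (W i \<inter> U i))"
proof -
  obtain x v f where x: "x \<in> W i0 \<inter> U i0" and fx: "dot f x \<noteq> 0"
    and H: "\<forall>t. transvection t v f \<in> H"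
    and v: "\<forall>i\<in>I. subspace_sum (W i) (U i) \<noteq> UNIV \<longrightarrow> v \<notin> subspace_sum (W i) (U i)"
    by (rule ex_transvection_avoiding_nonspanning_sums[OF I sub i0])
  define T where "T i = {t. subspace_sum (W i) ((*v) (transvection t v f) ` U i) \<noteq> UNIV}" for i
  define Good where "Good = {i \<in> I. subspace_sum (W i) (U i) = UNIV}"
  have "finite (T i)" if "i \<in> Good" for i
    unfolding T_def using that sub unfolding Good_def
    by (intro finite_transvection_params_not_spanning) auto
  then have "finite (insert 0 (\<Union>i\<in>Good. T i))"
    using I by (simp add: Good_def)
  from ex_new_if_finite[OF infinite_field this]
  obtain t where t: "t \<notin> insert 0 (\<Union>i\<in>Good. T i)" ..
  have tau: "invertible (transvection t v f)"
    using H invertible_mem by blast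
  have le: "vec.dim (W i \<inter> (*v) (transvection t v f) ` U i) \<le> vec.dim (W i \<inter> U i)"
    if i: "i \<in> I" for i
  proof (cases "i \<in> Good")
    case True
    with t have "subspace_sum (W i) (U i) = UNIV"
      "subspace_sum (W i) ((*v) (transvection t v f) ` U i) = UNIV"
      unfolding Good_def T_def by auto
    with sub i show ?thesis
      by (intro eq_imp_le dim_Int_eq_if_subspace_sums_UNIV[OF _ _ tau]) auto
  next
    case False
    with v i have "v \<notin> subspace_sum (W i) (U i)"
      unfolding Good_def by blast
    with sub i t show ?thesis
      by (intro dim_Int_transvection_image_le) auto
  qed
  have "i0 \<notin> Good"
    using i0 unfolding Good_def general_position_def by blast
  with v i0(1) have "v \<notin> subspace_sum (W i0) (U i0)"
    unfolding Good_def by blast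
  with sub i0(1) t x fx
  have "vec.dim (W i0 \<inter> (*v) (transvection t v f) ` U i0) < vec.dim (W i0 \<inter> U i0)"
    by (intro dim_Int_transvection_image_less) auto
  then have "(\<Sum>i\<in>I. vec.dim (W i \<inter> (*v) (transvection t v f) ` U i)) < (\<Sum>i\<in>I. vec.dim (W i \<inter> U i))"
    using le i0(1) by (intro sum_strict_mono_ex1[OF I]) auto
  with H show ?thesis by blast
qed

lemma ex_general_position:
  assumes I: "finite I" and sub: "\<forall>i\<in>I. vec.subspace (W i) \<and> vec.subspace (U i)"
  shows "\<exists>g\<in>H. \<forall>i\<in>I. general_position (W i) ((*v) g ` U i)"
proof -
  define overlap where "overlap g = (\<Sum>i\<in>I. vec.dim (W i \<inter> (*v) g ` U i))" for g
  obtain g where g: "g \<in> H" and min: "\<And>h. h \<in> H \<Longrightarrow> overlap g \<le> overlap h"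
    using ex_has_least_nat[of "\<lambda>g. g \<in> H" "mat 1" overlap] one_mem by blast
  have "general_position (W i) ((*v) g ` U i)" if i: "i \<in> I" for i
  proof (rule ccontr)
    assume bad: "\<not> general_position (W i) ((*v) g ` U i)"
    have "\<forall>i\<in>I. vec.subspace (W i) \<and> vec.subspace ((*v) g ` U i)"
      using sub subspace_matrix_image by blast
    from ex_transvection_decreasing_overlap[OF I this i bad]
    obtain h where "h \<in> H" and "(\<Sum>i\<in>I. vec.dim (W i \<inter> (*v) h ` (*v) g ` U i)) < overlap g"
      unfolding overlap_def by blast
    then have "overlap (h ** g) < overlap g"
      by (simp add: overlap_def image_image matrix_vector_mul_assoc)
    with min mult_mem[OF \<open>h \<in> H\<close> g] show False by fastforce
  qed
  with g show ?thesis by blast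
qed

text \<open>
  \<open>max 0 (\<Sum>j d\<^sub>j - n (e - 1))\<close> is the dimension of an intersection of subspaces of
  dimensions \<open>d\<^sub>j\<close> in general position.
\<close>

lemma ex_conjugators_dim_INT_le:
  assumes fin: "\<And>j. finite (F j)"
    and sub: "\<And>j U. U \<in> F j \<Longrightarrow> vec.subspace U \<and> vec.dim U \<le> d j"
    and d: "\<And>j. d j \<le> CARD('n)"
  shows "\<exists>g. (\<forall>j<e. g j \<in> H) \<and> (\<forall>U. (\<forall>j<e. U j \<in> F j) \<longrightarrow>
    int (vec.dim (\<Inter>j<e. (*v) (g j) ` U j)) \<le> max 0 ((\<Sum>j<e. int (d j)) - int CARD('n) * (int e - 1)))"
proof (induction e)
  case 0
  show ?case by (simp add: card_cart_basis)
next
  case (Suc e)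
  then obtain g where g: "\<forall>j<e. g j \<in> H" and IH: "\<And>U. \<forall>j<e. U j \<in> F j \<Longrightarrow>
      int (vec.dim (\<Inter>j<e. (*v) (g j) ` U j)) \<le> max 0 ((\<Sum>j<e. int (d j)) - int CARD('n) * (int e - 1))"
    by blast
  define W where "W U = (\<Inter>j<e. (*v) (g j) ` U j)" for U :: "nat \<Rightarrow> ('a ^'n) set"
  have W: "vec.subspace (W U)" if "\<forall>j<e. U j \<in> F j" for U
    unfolding W_def using that sub by (intro subspace_INT_lessThan subspace_matrix_image) blast
  have "\<exists>h\<in>H. \<forall>U\<in>Pi\<^sub>E {..<Suc e} F. general_position (W U) ((*v) h ` U e)"
    using W sub fin by (intro ex_general_position finite_PiE) (auto simp: PiE_def Pi_def)
  then obtain h where h: "h \<in> H"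
    and gp: "\<And>U. U \<in> Pi\<^sub>E {..<Suc e} F \<Longrightarrow> general_position (W U) ((*v) h ` U e)"
    by blast
  have "int (vec.dim (\<Inter>j<Suc e. (*v) ((g(e := h)) j) ` U j))
      \<le> max 0 ((\<Sum>j<Suc e. int (d j)) - int CARD('n) * (int (Suc e) - 1))"
    if U: "\<forall>j<Suc e. U j \<in> F j" for U
  proof -
    have inter: "(\<Inter>j<Suc e. (*v) ((g(e := h)) j) ` U j) = W U \<inter> (*v) h ` U e"
      by (auto simp: W_def lessThan_Suc)
    have "W U = W (restrict U {..<Suc e})"
      by (simp add: W_def)
    then have "general_position (W U) ((*v) h ` U e)"
      using gp[of "restrict U {..<Suc e}"] U by simp
    moreover have "vec.subspace (W U)" "vec.subspace (U e)"
      using W[of U] sub U by auto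
    ultimately have "int (vec.dim (W U \<inter> (*v) h ` U e))
        \<le> max 0 (int (vec.dim (W U)) + int (vec.dim (U e)) - int CARD('n))"
      using dim_Int_general_position subspace_matrix_image
        dim_image_invertible[OF invertible_mem[OF h]] by metis
    moreover have "int (vec.dim (W U)) \<le> max 0 ((\<Sum>j<e. int (d j)) - int CARD('n) * (int e - 1))"
      using IH U unfolding W_def by simp
    moreover have "vec.dim (U e) \<le> d e" "d e \<le> CARD('n)"
      using sub U d by auto
    moreover have "(\<Sum>j<Suc e. int (d j)) - int CARD('n) * (int (Suc e) - 1)
        = (\<Sum>j<e. int (d j)) - int CARD('n) * (int e - 1) + int (d e) - int CARD('n)"
      by (simp add: algebra_simps)
    ultimately show ?thesis
      unfolding inter by linarith
  qed
  moreover have "\<forall>j<Suc e. (g(e := h)) j \<in> H"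
    using g h by (simp add: less_Suc_eq)
  ultimately show ?case by blast
qed

end

section \<open>The general linear, special linear and symplectic groups\<close>

lemma infinite_UNIV_alg_closed: "infinite (UNIV :: 'a::alg_closed_field set)"
proof
  assume fin: "finite (UNIV :: 'a set)"
  define p :: "'a poly" where "p = (\<Prod>a\<in>UNIV. [:- a, 1:]) + 1"
  have "degree (\<Prod>a\<in>(UNIV :: 'a set). [:- a, 1:]) = card (UNIV :: 'a set)"
    by (subst degree_prod_sum_eq) auto
  moreover have "card (UNIV :: 'a set) > 0"
    using fin by (simp add: finite_UNIV_card_ge_0)
  ultimately have "degree p > 0"
    unfolding p_def by (metis degree_add_eq_left degree_1)
  then obtain x where "poly p x = 0"
    using alg_closed_imp_poly_has_root by blast
  moreover have "poly (\<Prod>a\<in>UNIV. [:- a, 1:]) x = 0"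
    by (simp add: poly_prod fin)
  ultimately show False by (simp add: p_def)
qed

lemma ex_dot_eq_0_dot_neq_0:
  fixes v x :: "'a::field ^'n"
  assumes "v \<noteq> 0" and not_parallel: "\<And>c. x \<noteq> c *s v"
  shows "\<exists>f. dot f v = 0 \<and> dot f x \<noteq> 0"
proof -
  obtain k where k: "v $ k \<noteq> 0"
    using assms(1) by (auto simp: vec_eq_iff)
  define f where "f i = axis i 1 - (v $ i / v $ k) *s axis k 1" for i
  have f: "dot (f i) y = y $ i - (v $ i / v $ k) * y $ k" for i y
    by (simp add: f_def dot_diff_left dot_scale_left)
  have "x = (x $ k / v $ k) *s v" if "\<forall>i. dot (f i) x = 0"
    using that k by (simp add: f vec_eq_iff field_simps)
  with not_parallel obtain i where "dot (f i) x \<noteq> 0" by blast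
  moreover have "dot (f i) v = 0"
    using k by (simp add: f)
  ultimately show ?thesis by blast
qed

lemma transvection_rich_group_GL:
  assumes "infinite (UNIV :: 'a set)"
  shows "transvection_rich_group {g :: 'a::field ^'n ^'n. invertible g}"
proof
  fix x :: "'a ^'n" and S :: "('a ^'n) set set"
  assume x: "x \<noteq> 0" "x \<in> \<Union>S" and S: "finite S" "\<forall>s\<in>S. vec.subspace s \<and> s \<noteq> UNIV"
  obtain v where v: "v \<notin> \<Union>S"
    using ex_not_in_finite_Union_proper_subspaces[OF assms S] by blast
  obtain s where s: "s \<in> S" "x \<in> s" using x by blast
  then have "vec.subspace s" "v \<notin> s" using S v by auto
  then have "v \<noteq> 0" "x \<noteq> c *s v" for c
    using s x(1) vec.subspace_0 vec.subspace_scale[of s x "1 / c"]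
    by (auto simp: vector_smult_assoc)
  then obtain f where "dot f v = 0" "dot f x \<noteq> 0"
    using ex_dot_eq_0_dot_neq_0 by blast
  with v show "\<exists>v f. v \<notin> \<Union>S \<and> dot f x \<noteq> 0 \<and> (\<forall>t. transvection t v f \<in> {g. invertible g})"
    using invertible_transvection by blast
qed (use assms in \<open>auto simp: invertible_det_nz det_mul\<close>)

lemma matrix_vector_mult_mat: "mat c *v x = c *s (x :: 'a::comm_ring_1 ^'n)"
  by (simp add: vec_eq_iff matrix_vector_mult_def mat_def mult_delta_left)

lemma image_scale_subspace:
  assumes "vec.subspace V" "c \<noteq> 0"
  shows "(\<lambda>x. c *s x) ` V = V"
proof
  show "(\<lambda>x. c *s x) ` V \<subseteq> V"
    using assms(1) vec.subspace_scale by blast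
  show "V \<subseteq> (\<lambda>x. c *s x) ` V"
  proof
    fix x assume "x \<in> V"
    then have "(1 / c) *s x \<in> V" "x = c *s ((1 / c) *s x)"
      using assms by (simp_all add: vec.subspace_scale vector_smult_assoc)
    then show "x \<in> (\<lambda>x. c *s x) ` V" by blast
  qed
qed

lemma ex_SL_same_subspace_images:
  fixes g :: "'a::alg_closed_field ^'n ^'n"
  assumes "invertible g"
  shows "\<exists>g'\<in>SL_group. \<forall>U. vec.subspace U \<longrightarrow> (*v) g' ` U = (*v) g ` U"
proof -
  have det: "det g \<noteq> 0"
    using assms by (simp add: invertible_det_nz)
  obtain c :: 'a where c: "c ^ CARD('n) = inverse (det g)"
    using nth_root_exists[of "CARD('n)"] by auto
  then have "c \<noteq> 0"
    using det by (auto simp: power_0_left)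
  have "det (mat c ** g) = 1"
    using c det by (simp add: det_mul det_diagonal mat_def)
  moreover have "(*v) (mat c ** g) ` U = (*v) g ` U" if "vec.subspace U" for U
  proof -
    have "(*v) (mat c ** g) ` U = (\<lambda>x. c *s x) ` (*v) g ` U"
      by (simp add: image_image matrix_vector_mult_mat flip: matrix_vector_mul_assoc)
    also have "\<dots> = (*v) g ` U"
      using image_scale_subspace[OF subspace_matrix_image[OF that] \<open>c \<noteq> 0\<close>] .
    finally show ?thesis .
  qed
  ultimately show ?thesis
    unfolding SL_group_def by blast
qed

lemma sum_sum_antisymmetric_eq_0:
  fixes g :: "'i \<Rightarrow> 'i \<Rightarrow> 'a::comm_ring_1"
  assumes "finite A" and antisym: "\<And>i j. g i j = - g j i" and diag: "\<And>i. g i i = 0"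
  shows "(\<Sum>i\<in>A. \<Sum>j\<in>A. g i j) = 0"
  using assms(1)
proof (induction A rule: finite_induct)
  case (insert a A)
  have "(\<Sum>i\<in>insert a A. \<Sum>j\<in>insert a A. g i j)
      = (\<Sum>j\<in>A. g a j + g j a) + (\<Sum>i\<in>A. \<Sum>j\<in>A. g i j)"
    using insert.hyps by (simp add: diag sum.distrib)
  also have "\<dots> = 0"
    using insert.IH by (simp add: antisym[of a])
  finally show ?case .
qed simp

text \<open>In characteristic 2 the first identity needs the zero diagonal, not just antisymmetry.\<close>

lemma
  assumes "alternating_nondeg J"
  shows alternating_dot_self: "dot v (J *v v) = 0"
    and alternating_dot_swap: "dot v (J *v z) = - dot (J *v v) z"
proof -
  have tJ: "transpose J = - J" and diag: "J $ i $ i = 0" for i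
    using assms unfolding alternating_nondeg_def by auto
  have antisym: "J $ i $ j = - J $ j $ i" for i j
    using arg_cong[OF tJ, of "\<lambda>A. A $ j $ i"] by (simp add: transpose_def)
  have "dot v (J *v v) = (\<Sum>i\<in>UNIV. \<Sum>j\<in>UNIV. v $ i * J $ i $ j * v $ j)"
    by (simp add: dot_def matrix_vector_mult_def sum_distrib_left mult_ac)
  also have "\<dots> = 0"
  proof (rule sum_sum_antisymmetric_eq_0)
    show "v $ i * J $ i $ j * v $ j = - (v $ j * J $ j $ i * v $ i)" for i j
      by (simp add: antisym[of i j] mult_ac)
  qed (simp_all add: diag)
  finally show "dot v (J *v v) = 0" .
  have "transpose (- J) = J"
    using tJ by (metis transpose_transpose)
  then have "dot v (J *v z) = dot ((- J) *v v) z"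
    using dot_transpose[of v "- J" z] by simp
  also have "(- J) *v v = - (J *v v)"
    by (simp add: vec_eq_iff matrix_vector_mult_def sum_negf)
  finally show "dot v (J *v z) = - dot (J *v v) z"
    by (simp add: dot_neg_left)
qed

lemma invertible_Sp:
  assumes "alternating_nondeg J" "A \<in> Sp_group J"
  shows "invertible A"
proof -
  have "det A * det J * det A = det J"
    using assms(2) det_mul[of "transpose A ** J" A] by (simp add: Sp_group_def det_mul)
  moreover have "det J \<noteq> 0"
    using assms(1) by (simp add: alternating_nondeg_def)
  ultimately show ?thesis
    by (auto simp: invertible_det_nz)
qed

lemma transvection_in_Sp:
  assumes J: "alternating_nondeg J"
  shows "transvection t v (J *v v) \<in> Sp_group J"
proof -
  let ?T = "transvection t v (J *v v)"
  have "(transpose ?T ** J ** ?T) *v z = J *v z" for z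
  proof -
    define a where "a = t * dot (J *v v) z"
    have "J *v (?T *v z) = J *v z + a *s (J *v v)"
      by (simp add: a_def transvection_apply matrix_vector_right_distrib vector_scalar_commute)
    moreover have "dot v (J *v z + a *s (J *v v)) = - dot (J *v v) z"
      using alternating_dot_self[OF J] alternating_dot_swap[OF J]
      by (simp add: dot_add_right dot_scale_right)
    ultimately have "transvection t (J *v v) v *v (J *v (?T *v z))
        = J *v z + a *s (J *v v) + (t * - dot (J *v v) z) *s (J *v v)"
      by (simp only: transvection_apply)
    also have "\<dots> = J *v z"
      by (simp add: a_def vec_eq_iff algebra_simps)
    finally show ?thesis
      by (simp add: transpose_transvection matrix_vector_mul_assoc matrix_mul_assoc)
  qed
  then show ?thesis
    by (simp add: Sp_group_def matrix_eq)
qed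

lemma transvection_rich_group_Sp:
  assumes inf: "infinite (UNIV :: 'a set)" and J: "alternating_nondeg (J :: 'a::field ^'n ^'n)"
  shows "transvection_rich_group (Sp_group J)"
proof
  fix x :: "'a ^'n" and S :: "('a ^'n) set set"
  assume x: "x \<noteq> 0" and S: "finite S" "\<forall>s\<in>S. vec.subspace s \<and> s \<noteq> UNIV"
  define a where "a = transpose J *v x"
  have "invertible (transpose J)"
    using J unfolding invertible_det_nz det_transpose alternating_nondeg_def by blast
  then have "a \<noteq> 0"
    using x inj_matrix_vector_mult unfolding a_def by (metis injD matrix_vector_mult_0_right)
  then obtain i where i: "a $ i \<noteq> 0"
    by (auto simp: vec_eq_iff)
  define Z where "Z = {v. dot a v = 0}"
  have "vec.subspace Z"
    unfolding Z_def vec.subspace_def by (simp add: dot_add_right dot_scale_right)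
  moreover have "axis i 1 \<notin> Z"
    using i by (simp add: Z_def dot_commute[of a])
  ultimately obtain v where v: "v \<notin> \<Union>(insert Z S)"
    using ex_not_in_finite_Union_proper_subspaces[OF inf, of "insert Z S"] S by blast
  have "dot (J *v v) x = dot a v"
    using dot_transpose[of x "transpose J" v] by (simp add: a_def dot_commute)
  with v have "dot (J *v v) x \<noteq> 0"
    by (simp add: Z_def)
  with v show "\<exists>v f. v \<notin> \<Union>S \<and> dot f x \<noteq> 0 \<and> (\<forall>t. transvection t v f \<in> Sp_group J)"
    using transvection_in_Sp[OF J] by blast
next
  show "mat 1 \<in> Sp_group J"
    by (simp add: Sp_group_def)
  show "A ** B \<in> Sp_group J" if "A \<in> Sp_group J" "B \<in> Sp_group J" for A B
  proof -
    have "transpose (A ** B) ** J ** (A ** B) = transpose B ** (transpose A ** J ** A) ** B"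
      by (simp add: matrix_transpose_mul matrix_mul_assoc)
    with that show ?thesis
      by (simp add: Sp_group_def)
  qed
qed (use inf invertible_Sp[OF J] in auto)

lemma SL_Sp_invertible:
  assumes "G = SL_group \<or> (\<exists>J. alternating_nondeg J \<and> G = Sp_group J)"
  shows "\<forall>a\<in>G. invertible a"
  using assms invertible_Sp by (auto simp: SL_group_def invertible_det_nz)

section \<open>Eigenspaces and fixed lines\<close>

lemma matrix_inv_mult:
  assumes "invertible A"
  shows matrix_inv_right: "A ** matrix_inv A = mat 1"
    and matrix_inv_left: "matrix_inv A ** A = mat 1"
  using someI_ex[OF assms[unfolded invertible_def]] unfolding matrix_inv_def by auto

lemma invertible_conj_class:
  fixes G :: "('a::field ^'n ^'n) set"
  assumes "\<forall>a\<in>G. invertible a" "c \<in> G" "x \<in> conj_class G c"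
  shows "invertible x"
proof -
  obtain g where g: "g \<in> G" "x = g ** c ** matrix_inv g"
    using assms(3) unfolding conj_class_def by blast
  have "invertible g"
    using assms(1) g(1) by blast
  then have "invertible (matrix_inv g)"
    using matrix_inv_mult unfolding invertible_def by blast
  then show ?thesis
    using assms(1,2) g \<open>invertible g\<close> by (simp add: invertible_mult)
qed

lemma subspace_eigenspace: "vec.subspace (eigenspace A c)"
  unfolding vec.subspace_def eigenspace_def
  by (simp add: matrix_vector_right_distrib vector_scalar_commute vector_add_ldistrib)

lemma eigenspace_conj:
  fixes g A :: "'a::field ^'n ^'n"
  assumes g: "invertible g"
  shows "eigenspace (g ** A ** matrix_inv g) c = (*v) g ` eigenspace A c"
proof -
  have ginv: "matrix_inv g *v (g *v y) = y" "g *v (matrix_inv g *v y) = y" for y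
    by (simp_all add: matrix_vector_mul_assoc matrix_inv_mult[OF g])
  have "y \<in> eigenspace (g ** A ** matrix_inv g) c \<longleftrightarrow> matrix_inv g *v y \<in> eigenspace A c" for y
  proof -
    define z where "z = matrix_inv g *v y"
    have "(g ** A ** matrix_inv g) *v y = g *v (A *v z)"
      by (simp add: z_def matrix_vector_mul_assoc matrix_mul_assoc)
    moreover have "c *s y = g *v (c *s z)"
      by (simp add: z_def vector_scalar_commute ginv)
    ultimately have "(g ** A ** matrix_inv g) *v y = c *s y \<longleftrightarrow> A *v z = c *s z"
      using inj_matrix_vector_mult[OF g] by (simp add: inj_eq)
    then show ?thesis
      by (simp add: eigenspace_def z_def)
  qed
  moreover have "y \<in> (*v) g ` E \<longleftrightarrow> matrix_inv g *v y \<in> E" for y E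
  proof
    show "y \<in> (*v) g ` E \<Longrightarrow> matrix_inv g *v y \<in> E"
      by (auto simp: ginv)
    show "matrix_inv g *v y \<in> E \<Longrightarrow> y \<in> (*v) g ` E"
      by (rule image_eqI[where x = "matrix_inv g *v y"]) (simp_all add: ginv)
  qed
  ultimately show ?thesis by blast
qed

lemma sum_eigenvectors_eq_0:
  fixes A :: "'a::field ^'n ^'n"
  assumes "finite L" and "\<And>c. c \<in> L \<Longrightarrow> A *v w c = c *s w c" and "(\<Sum>c\<in>L. w c) = 0"
  shows "\<forall>c\<in>L. w c = 0"
  using assms
proof (induction L arbitrary: w rule: finite_induct)
  case (insert m L)
  have "(\<Sum>c\<in>L. (c - m) *s w c) = (\<Sum>c\<in>insert m L. (c - m) *s w c)"
    using insert.hyps by simp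
  also have "\<dots> = (\<Sum>c\<in>insert m L. A *v w c) - m *s (\<Sum>c\<in>insert m L. w c)"
    using insert.prems(1)
    by (simp add: vec.scale_left_diff_distrib sum_subtractf vec.scale_sum_right del: sum.insert)
  also have "\<dots> = 0"
    using insert.prems(2) by (simp add: vec.sum[symmetric] del: sum.insert)
  finally have sum0: "(\<Sum>c\<in>L. (c - m) *s w c) = 0" .
  have "A *v ((c - m) *s w c) = c *s ((c - m) *s w c)" if "c \<in> L" for c
  proof -
    have "A *v w c = c *s w c"
      using insert.prems(1) that by simp
    then show ?thesis
      by (metis vector_scalar_commute vector_smult_assoc mult.commute)
  qed
  then have "\<forall>c\<in>L. (c - m) *s w c = 0"
    using insert.IH[of "\<lambda>c. (c - m) *s w c"] sum0 by blast
  then have "\<forall>c\<in>L. w c = 0"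
    using insert.hyps(2) by auto
  with insert.prems(2) insert.hyps show ?case
    by simp
qed simp

lemma finite_eigenvalues: "finite {c. eigenspace (A :: 'a::field ^'n ^'n) c \<noteq> {0}}"
proof (rule ccontr)
  assume "infinite {c. eigenspace A c \<noteq> {0}}"
  then obtain L where L: "finite L" "card L = Suc CARD('n)" "L \<subseteq> {c. eigenspace A c \<noteq> {0}}"
    using infinite_arbitrarily_large by blast
  have "\<exists>x. x \<noteq> 0 \<and> A *v x = c *s x" if "c \<in> L" for c
    using L(3) that unfolding eigenspace_def by auto
  then obtain w where w: "\<And>c. c \<in> L \<Longrightarrow> w c \<noteq> 0 \<and> A *v w c = c *s w c"
    by metis
  have inj: "inj_on w L"
  proof
    fix c c' assume "c \<in> L" "c' \<in> L" "w c = w c'"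
    then have "c *s w c = c' *s w c"
      using w by metis
    then have "(c - c') *s w c = 0"
      by (simp add: vec.scale_left_diff_distrib)
    with w \<open>c \<in> L\<close> show "c = c'" by simp
  qed
  have "vec.independent (w ` L)"
    unfolding vec.independent_explicit
  proof (intro conjI allI impI)
    show "finite (w ` L)" using L(1) by simp
    fix u assume "(\<Sum>x\<in>w ` L. u x *s x) = 0"
    then have sum: "(\<Sum>c\<in>L. u (w c) *s w c) = 0"
      by (simp add: sum.reindex[OF inj])
    have eig: "A *v (u (w c) *s w c) = c *s (u (w c) *s w c)" if "c \<in> L" for c
      using w[OF that] by (metis vector_scalar_commute vector_smult_assoc mult.commute)
    have "\<forall>c\<in>L. u (w c) *s w c = 0"
      using sum_eigenvectors_eq_0[OF L(1) eig sum] .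
    then show "\<forall>x\<in>w ` L. u x = 0"
      using w by auto
  qed
  then have "card (w ` L) \<le> CARD('n)"
    using vec.independent_bound_general[of "w ` L"] dim_le_CARD[of "w ` L"] by linarith
  with L(2) card_image[OF inj] show False by simp
qed

lemma
  fixes A :: "'a::field ^'n ^'n"
  shows dim_eigenspace_le_max: "vec.dim (eigenspace A c) \<le> max_eigenspace_dim A"
    and ex_eigenspace_max_dim: "\<exists>c. vec.dim (eigenspace A c) = max_eigenspace_dim A"
proof -
  have fin: "finite {vec.dim (eigenspace A c) | c. True}"
    by (rule finite_subset[of _ "{..CARD('n)}"]) (auto simp: dim_le_CARD)
  show "vec.dim (eigenspace A c) \<le> max_eigenspace_dim A"
    unfolding max_eigenspace_dim_def by (rule Max_ge[OF fin]) blast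
  have "max_eigenspace_dim A \<in> {vec.dim (eigenspace A c) | c. True}"
    unfolding max_eigenspace_dim_def by (rule Max_in[OF fin]) auto
  then show "\<exists>c. vec.dim (eigenspace A c) = max_eigenspace_dim A"
    by auto
qed

lemma max_eigenspace_dim_le_CARD: "max_eigenspace_dim (A :: 'a::field ^'n ^'n) \<le> CARD('n)"
  using ex_eigenspace_max_dim[of A] dim_le_CARD by metis

lemma ex_line_span:
  assumes "vec.subspace L" "vec.dim L = 1"
  shows "\<exists>v. v \<noteq> 0 \<and> L = vec.span {v}"
proof -
  obtain v where v: "v \<in> L" "v \<noteq> 0"
    using assms(2) vec.dim_eq_0[of L] by auto
  have "vec.span {v} \<subseteq> L"
    using v assms(1) by (simp add: vec.span_minimal)
  moreover have "vec.dim L \<le> vec.dim (vec.span {v})"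
    using assms(2) v(2) by (simp add: vec.dim_insert vec.span_empty)
  ultimately have "vec.span {v} = L"
    using vec.subspace_dim_equal[OF vec.subspace_span assms(1)] by blast
  with v show ?thesis by blast
qed

lemma fixes_span_singleton_iff:
  assumes "invertible A" "v \<noteq> 0"
  shows "fixes_subspace A (vec.span {v}) \<longleftrightarrow> (\<exists>c. A *v v = c *s v)"
proof
  assume "fixes_subspace A (vec.span {v})"
  then have "A *v v \<in> vec.span {v}"
    unfolding fixes_subspace_def by (metis image_eqI vec.span_base singletonI)
  then show "\<exists>c. A *v v = c *s v"
    by (auto simp: vec.span_singleton)
next
  assume "\<exists>c. A *v v = c *s v"
  then obtain c where c: "A *v v = c *s v" by blast
  have "c \<noteq> 0"
  proof
    assume "c = 0"
    with c have "A *v v = A *v 0" by simp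
    then have "v = 0"
      using injD[OF inj_matrix_vector_mult[OF assms(1)]] by blast
    with assms(2) show False ..
  qed
  have "(\<lambda>x. A *v x) ` range (\<lambda>k. k *s v) = range (\<lambda>k. k *s v)"
  proof
    have "A *v (k *s v) = (k * c) *s v" for k
      by (simp add: c vector_scalar_commute vector_smult_assoc)
    then show "(\<lambda>x. A *v x) ` range (\<lambda>k. k *s v) \<subseteq> range (\<lambda>k. k *s v)"
      by auto
    have "k *s v = A *v ((k / c) *s v)" for k
      using \<open>c \<noteq> 0\<close> by (simp add: c vector_scalar_commute vector_smult_assoc)
    then show "range (\<lambda>k. k *s v) \<subseteq> (\<lambda>x. A *v x) ` range (\<lambda>k. k *s v)"
      by blast
  qed
  then show "fixes_subspace A (vec.span {v})"
    by (simp add: fixes_subspace_def vec.span_singleton)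
qed

lemma fixed_line_iff_common_eigenvector:
  assumes "\<forall>j<e. invertible (x j)"
  shows "(\<exists>L. vec.subspace L \<and> vec.dim L = 1 \<and> (\<forall>j<e. fixes_subspace (x j) L))
    \<longleftrightarrow> (\<exists>v. v \<noteq> 0 \<and> (\<forall>j<e. \<exists>c. x j *v v = c *s v))"
proof
  assume "\<exists>L. vec.subspace L \<and> vec.dim L = 1 \<and> (\<forall>j<e. fixes_subspace (x j) L)"
  then obtain L where L: "vec.subspace L" "vec.dim L = 1" "\<forall>j<e. fixes_subspace (x j) L"
    by blast
  then obtain v where "v \<noteq> 0" "L = vec.span {v}"
    using ex_line_span by blast
  with L(3) assms show "\<exists>v. v \<noteq> 0 \<and> (\<forall>j<e. \<exists>c. x j *v v = c *s v)"
    using fixes_span_singleton_iff by blast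
next
  assume "\<exists>v. v \<noteq> 0 \<and> (\<forall>j<e. \<exists>c. x j *v v = c *s v)"
  then obtain v where v: "v \<noteq> 0" "\<forall>j<e. \<exists>c. x j *v v = c *s v"
    by blast
  have "vec.dim (vec.span {v}) = 1"
    using v(1) by (simp add: vec.dim_insert vec.span_empty)
  with v assms show "\<exists>L. vec.subspace L \<and> vec.dim L = 1 \<and> (\<forall>j<e. fixes_subspace (x j) L)"
    using fixes_span_singleton_iff vec.subspace_span by blast
qed


section \<open>Conjugates with and without a common eigenvector\<close>

lemma common_eigenvector_if_large:
  fixes c x :: "nat \<Rightarrow> 'a::field ^'n ^'n"
  assumes Ginv: "\<forall>a\<in>G. invertible a" and x: "\<forall>j<e. x j \<in> conj_class G (c j)"
    and large: "int CARD('n) * (int e - 1) < int (\<Sum>j<e. max_eigenspace_dim (c j))"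
  shows "\<exists>v. v \<noteq> 0 \<and> (\<forall>j<e. \<exists>m. x j *v v = m *s v)"
proof -
  obtain m where m: "\<And>j. vec.dim (eigenspace (c j) (m j)) = max_eigenspace_dim (c j)"
    using choice[OF allI[OF ex_eigenspace_max_dim]] by blast
  define E where "E j = eigenspace (x j) (m j)" for j
  have "vec.dim (E j) = max_eigenspace_dim (c j)" if j: "j < e" for j
  proof -
    obtain g where "g \<in> G" "x j = g ** c j ** matrix_inv g"
      using x j unfolding conj_class_def by blast
    with Ginv show ?thesis
      by (simp add: E_def eigenspace_conj dim_image_invertible m)
  qed
  then have "(\<Sum>j<e. int (vec.dim (E j))) = int (\<Sum>j<e. max_eigenspace_dim (c j))"
    by simp
  moreover have "(\<Sum>j<e. int (vec.dim (E j))) - int CARD('n) * (int e - 1) \<le> int (vec.dim (\<Inter>j<e. E j))"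
    by (rule dim_INT_ge) (simp add: E_def subspace_eigenspace)
  ultimately have "0 < int (vec.dim (\<Inter>j<e. E j))"
    using large by linarith
  then have "vec.dim (\<Inter>j<e. E j) \<noteq> 0"
    by linarith
  then have "\<not> (\<Inter>j<e. E j) \<subseteq> {0}"
    by (simp add: vec.dim_eq_0)
  then obtain v where "v \<in> (\<Inter>j<e. E j)" "v \<noteq> 0"
    by blast
  then show ?thesis
    by (auto simp: E_def eigenspace_def)
qed

lemma ex_conjugators_INT_trivial:
  fixes G :: "('a::alg_closed_field ^'n ^'n) set"
  assumes G: "G = SL_group \<or> (\<exists>J. alternating_nondeg J \<and> G = Sp_group J)"
    and fin: "\<And>j. finite (F j)"
    and sub: "\<And>j U. U \<in> F j \<Longrightarrow> vec.subspace U \<and> vec.dim U \<le> d j"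
    and d: "\<And>j. d j \<le> CARD('n)"
    and small: "(\<Sum>j<e. int (d j)) \<le> int CARD('n) * (int e - 1)"
  shows "\<exists>g. (\<forall>j<e. g j \<in> G) \<and> (\<forall>U. (\<forall>j<e. U j \<in> F j) \<longrightarrow> (\<Inter>j<e. (*v) (g j) ` U j) \<subseteq> {0})"
proof -
  have trivial: "\<exists>g. (\<forall>j<e. g j \<in> H) \<and> (\<forall>U. (\<forall>j<e. U j \<in> F j) \<longrightarrow> (\<Inter>j<e. (*v) (g j) ` U j) \<subseteq> {0})"
    if H: "transvection_rich_group H" for H :: "('a ^'n ^'n) set"
  proof -
    have "\<exists>g. (\<forall>j<e. g j \<in> H) \<and> (\<forall>U. (\<forall>j<e. U j \<in> F j) \<longrightarrow>
        int (vec.dim (\<Inter>j<e. (*v) (g j) ` U j)) \<le> max 0 ((\<Sum>j<e. int (d j)) - int CARD('n) * (int e - 1)))"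
      by (rule transvection_rich_group.ex_conjugators_dim_INT_le[OF H fin]) (simp_all add: sub d)
    then obtain g where g: "\<forall>j<e. g j \<in> H" and bound: "\<forall>U. (\<forall>j<e. U j \<in> F j) \<longrightarrow>
        int (vec.dim (\<Inter>j<e. (*v) (g j) ` U j)) \<le> max 0 ((\<Sum>j<e. int (d j)) - int CARD('n) * (int e - 1))"
      by (elim exE conjE)
    have "vec.dim (\<Inter>j<e. (*v) (g j) ` U j) = 0" if "\<forall>j<e. U j \<in> F j" for U
    proof -
      have "int (vec.dim (\<Inter>j<e. (*v) (g j) ` U j))
          \<le> max 0 ((\<Sum>j<e. int (d j)) - int CARD('n) * (int e - 1))"
        using bound that by blast
      with small show ?thesis by linarith
    qed
    then have "(\<Inter>j<e. (*v) (g j) ` U j) \<subseteq> {0}" if "\<forall>j<e. U j \<in> F j" for U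
      using that vec.dim_eq_0 by blast
    with g show ?thesis by blast
  qed
  from G show ?thesis
  proof
    assume SL: "G = SL_group"
    obtain g :: "nat \<Rightarrow> 'a ^'n ^'n" where g: "\<forall>j<e. invertible (g j)"
      and triv: "\<forall>U. (\<forall>j<e. U j \<in> F j) \<longrightarrow> (\<Inter>j<e. (*v) (g j) ` U j) \<subseteq> {0}"
      using trivial[OF transvection_rich_group_GL[OF infinite_UNIV_alg_closed]] by auto
    have "\<forall>j\<in>{..<e}. \<exists>g'. g' \<in> SL_group \<and> (\<forall>U. vec.subspace U \<longrightarrow> (*v) g' ` U = (*v) (g j) ` U)"
      using ex_SL_same_subspace_images g by blast
    from bchoice[OF this] obtain g' where
      g': "\<forall>j\<in>{..<e}. g' j \<in> SL_group \<and> (\<forall>U. vec.subspace U \<longrightarrow> (*v) (g' j) ` U = (*v) (g j) ` U)"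
      by blast
    show ?thesis
    proof (intro exI conjI)
      show "\<forall>j<e. g' j \<in> G"
        using SL g' by blast
      show "\<forall>U. (\<forall>j<e. U j \<in> F j) \<longrightarrow> (\<Inter>j<e. (*v) (g' j) ` U j) \<subseteq> {0}"
      proof (intro allI impI)
        fix U assume U: "\<forall>j<e. U j \<in> F j"
        have "(\<Inter>j<e. (*v) (g' j) ` U j) = (\<Inter>j<e. (*v) (g j) ` U j)"
        proof (rule INF_cong[OF refl])
          fix j assume "j \<in> {..<e}"
          moreover have "vec.subspace (U j)"
            using U sub calculation by blast
          ultimately show "(*v) (g' j) ` U j = (*v) (g j) ` U j"
            using g' by blast
        qed
        with U triv show "(\<Inter>j<e. (*v) (g' j) ` U j) \<subseteq> {0}"
          by simp
      qed
    qed
  next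
    assume "\<exists>J. alternating_nondeg J \<and> G = Sp_group J"
    then obtain J where "alternating_nondeg J" "G = Sp_group J" by blast
    then show ?thesis
      using trivial[OF transvection_rich_group_Sp[OF infinite_UNIV_alg_closed]] by simp
  qed
qed

lemma ex_conj_without_common_eigenvector:
  fixes c :: "nat \<Rightarrow> 'a::alg_closed_field ^'n ^'n"
  assumes G: "G = SL_group \<or> (\<exists>J. alternating_nondeg J \<and> G = Sp_group J)"
    and small: "int (\<Sum>j<e. max_eigenspace_dim (c j)) \<le> int CARD('n) * (int e - 1)"
  shows "\<exists>x. (\<forall>j<e. x j \<in> conj_class G (c j)) \<and> \<not> (\<exists>v. v \<noteq> 0 \<and> (\<forall>j<e. \<exists>m. x j *v v = m *s v))"
proof -
  define F where "F j = (\<lambda>m. eigenspace (c j) m) ` {m. eigenspace (c j) m \<noteq> {0}}" for j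
  have fin: "finite (F j)" for j
    unfolding F_def using finite_eigenvalues by (rule finite_imageI)
  have sub: "vec.subspace U \<and> vec.dim U \<le> max_eigenspace_dim (c j)" if "U \<in> F j" for j U
    using that unfolding F_def by (auto simp: subspace_eigenspace dim_eigenspace_le_max)
  have "\<exists>g. (\<forall>j<e. g j \<in> G) \<and> (\<forall>U. (\<forall>j<e. U j \<in> F j) \<longrightarrow> (\<Inter>j<e. (*v) (g j) ` U j) \<subseteq> {0})"
    using sub max_eigenspace_dim_le_CARD small by (intro ex_conjugators_INT_trivial[OF G fin]) simp_all
  then obtain g where g: "\<forall>j<e. g j \<in> G"
    and trivial: "\<forall>U. (\<forall>j<e. U j \<in> F j) \<longrightarrow> (\<Inter>j<e. (*v) (g j) ` U j) \<subseteq> {0}"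
    by (elim exE conjE)
  define x where "x j = g j ** c j ** matrix_inv (g j)" for j
  have "\<not> (\<exists>v. v \<noteq> 0 \<and> (\<forall>j<e. \<exists>m. x j *v v = m *s v))"
  proof
    assume "\<exists>v. v \<noteq> 0 \<and> (\<forall>j<e. \<exists>m. x j *v v = m *s v)"
    then obtain v where v: "v \<noteq> 0" and "\<forall>j\<in>{..<e}. \<exists>m. x j *v v = m *s v"
      by auto
    from bchoice[OF this(2)] obtain m where m: "\<forall>j\<in>{..<e}. x j *v v = m j *s v"
      by blast
    have v_in: "v \<in> (*v) (g j) ` eigenspace (c j) (m j)" if j: "j < e" for j
    proof -
      have "v \<in> eigenspace (x j) (m j)"
        using m j by (simp add: eigenspace_def)
      moreover have "invertible (g j)"
        using g j SL_Sp_invertible[OF G] by blast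
      then have "eigenspace (x j) (m j) = (*v) (g j) ` eigenspace (c j) (m j)"
        unfolding x_def by (rule eigenspace_conj)
      ultimately show ?thesis
        by simp
    qed
    have F: "eigenspace (c j) (m j) \<in> F j" if j: "j < e" for j
    proof -
      obtain w where w: "w \<in> eigenspace (c j) (m j)" "v = g j *v w"
        using v_in[OF j] by blast
      with v have "w \<noteq> 0"
        by auto
      with w(1) have "eigenspace (c j) (m j) \<noteq> {0}"
        by blast
      then show ?thesis
        unfolding F_def by blast
    qed
    have "(\<Inter>j<e. (*v) (g j) ` eigenspace (c j) (m j)) \<subseteq> {0}"
      by (rule trivial[rule_format]) (simp add: F)
    moreover have "v \<in> (\<Inter>j<e. (*v) (g j) ` eigenspace (c j) (m j))"
      using v_in by simp
    ultimately show False
      using v by auto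
  qed
  moreover have "\<forall>j<e. x j \<in> conj_class G (c j)"
    using g unfolding conj_class_def x_def by auto
  ultimately show ?thesis
    by (intro exI[of _ x] conjI)
qed


theorem lemma2p4:
  fixes G :: "('a::alg_closed_field ^'n ^'n) set"
    and e :: nat
    and c :: "nat \<Rightarrow> 'a ^'n ^'n"
  assumes G: "G = SL_group \<or> (\<exists>J. alternating_nondeg J \<and> G = Sp_group J)"
    and c: "\<forall>j<e. c j \<in> G"
  shows "(int (\<Sum>j<e. max_eigenspace_dim (c j)) \<le> int CARD('n) * (int e - 1)) \<longleftrightarrow>
         (\<exists>x :: nat \<Rightarrow> 'a ^'n ^'n. (\<forall>j<e. x j \<in> conj_class G (c j)) \<and>
            \<not> (\<exists>L. vec.subspace L \<and> vec.dim L = 1 \<and> (\<forall>j<e. fixes_subspace (x j) L)))"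
    (is "?small \<longleftrightarrow> (\<exists>x. ?conj x \<and> \<not> ?fixed_line x)")
proof -
  have Ginv: "\<forall>a\<in>G. invertible a"
    using G by (rule SL_Sp_invertible)
  have fixed_line_iff: "?fixed_line x \<longleftrightarrow> (\<exists>v. v \<noteq> 0 \<and> (\<forall>j<e. \<exists>m. x j *v v = m *s v))"
    if "?conj x" for x
    using that c invertible_conj_class[OF Ginv] by (intro fixed_line_iff_common_eigenvector) blast
  show ?thesis
  proof
    assume ?small
    from ex_conj_without_common_eigenvector[OF G this]
    obtain x where x: "?conj x" and "\<not> (\<exists>v. v \<noteq> 0 \<and> (\<forall>j<e. \<exists>m. x j *v v = m *s v))"
      by (elim exE conjE)
    then have "\<not> ?fixed_line x"
      unfolding fixed_line_iff[OF x] by blast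
    with x show "\<exists>x. ?conj x \<and> \<not> ?fixed_line x"
      by blast
  next
    assume "\<exists>x. ?conj x \<and> \<not> ?fixed_line x"
    then obtain x where x: "?conj x" and "\<not> ?fixed_line x"
      by (elim exE conjE)
    then have no_common: "\<not> (\<exists>v. v \<noteq> 0 \<and> (\<forall>j<e. \<exists>m. x j *v v = m *s v))"
      unfolding fixed_line_iff[OF x] by blast
    show ?small
    proof (rule ccontr)
      assume "\<not> ?small"
      then have "int CARD('n) * (int e - 1) < int (\<Sum>j<e. max_eigenspace_dim (c j))"
        by linarith
      from common_eigenvector_if_large[OF Ginv x this] no_common show False
        by contradiction
    qed
  qed
qed

end
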